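(* Let $t_0\in\mathbf C$, $r>0$, and let $f$ be a complex holomorphic function in a neighbourhood $B(t_0,r,\mathbf C)$ of $t_0$. Then there exist $a\in\mathbf H$ with $a_{1,1}=t_0$ and a quaternion $z$-analytic function $g$ on the neighbourhood $B(a,r,\mathbf H)$ of $a$ such that $g_{1,1}(t,u_0)=f(t)$ for all $t\in B(t_0,r,\mathbf C)$, where $u_0=a_{1,2}$. Respectively, there exist $a\in\mathbf H$ with $a_{1,2}=t_0$ and a quaternion $z$-analytic function $g$ on $B(a,r,\mathbf H)$ such that $g_{1,2}(u_0,t)=f(t)$ for all $t\in B(t_0,r,\mathbf C)$, where $u_0=a_{1,1}$.
   Context: $\mathbf H$ is the quaternion skew field realized as matrices $z=\begin{pmatrix}t&u\\-\bar u&\bar t\end{pmatrix}$, $t,u\in\mathbf C$; $z_{1,1}=t$, $z_{1,2}=u$, $|z|=(|t|^2+|u|^2)^{1/2}$. An $\mathbf H$-valued function $g$ has matrix entries $g_{j,k}$, and $g_{j,k}(t,u)$ is the value at the quaternion $z$ with $z_{1,1}=t$, $z_{1,2}=u$. $B(x,r,X):=\{y\in X:\ \rho_X(x,y)\le r\}$ is the ball in a metric space $(X,\rho_X)$. Quaternion $z$-analytic: for $b\in\mathbf H$, $R>0$ let $C^\omega_z(B(b,R,\mathbf H),\mathbf H)$ be the ($\mathbf R$-linear) completion of the space of finite products $f^1(z)\cdots f^l(z)$ of power series $f^s(z)=\sum_{n\ge0}f^s_n(z-b)^n$, $f^s_n\in\mathbf H$, convergent on the ball, relative to $\|f\|_\omega=\prod_{s}\sup_{n\ge0}|f^s_n|R^n$.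 A continuous function is (locally) $z$-analytic if near each point $b$ of its domain it coincides with an element of $C^\omega_z(B(b,R,\mathbf H),\mathbf H)$ for some $R>0$. *)

theory Defs
  imports "HOL-Analysis.Analysis"
begin

section \<open>The quaternion skew field as complex matrices\<close>

definition qmat :: "complex \<Rightarrow> complex \<Rightarrow> complex^2^2" where
  "qmat t u = vector [vector [t, u], vector [- cnj u, cnj t]]"

lemma qmat_nth [simp]:
  "qmat t u $ 1 $ 1 = t" "qmat t u $ 1 $ 2 = u"
  "qmat t u $ 2 $ 1 = - cnj u" "qmat t u $ 2 $ 2 = cnj t"
  by (simp_all add: qmat_def)

lemma mat2_eqI:
  fixes A B :: "complex^2^2"
  assumes "A $ 1 $ 1 = B $ 1 $ 1" "A $ 1 $ 2 = B $ 1 $ 2"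
    "A $ 2 $ 1 = B $ 2 $ 1" "A $ 2 $ 2 = B $ 2 $ 2"
  shows "A = B"
  using assms by (simp add: vec_eq_iff forall_2)

lemma qmat_0: "0 = qmat 0 0"
  and qmat_1: "mat 1 = qmat 1 0"
  and qmat_add: "qmat t u + qmat t' u' = qmat (t + t') (u + u')"
  and qmat_diff: "qmat t u - qmat t' u' = qmat (t - t') (u - u')"
  and qmat_minus: "- qmat t u = qmat (- t) (- u)"
  and qmat_scaleR: "r *\<^sub>R qmat t u = qmat (r *\<^sub>R t) (r *\<^sub>R u)"
  and qmat_mult: "qmat t u ** qmat t' u' = qmat (t * t' - u * cnj u') (t * u' + u * cnj t')"
  by (intro mat2_eqI; simp add: mat_def matrix_matrix_mult_def sum_2)+

typedef quat = "{qmat t u | t u. True}"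
  by blast

setup_lifting type_definition_quat

text \<open>\<open>Quat t u\<close> is the quaternion \<open>z\<close> with \<open>z\<^sub>1\<^sub>,\<^sub>1 = t\<close> and \<open>z\<^sub>1\<^sub>,\<^sub>2 = u\<close>.\<close>

lift_definition Quat :: "complex \<Rightarrow> complex \<Rightarrow> quat" is qmat
  by blast

lift_definition entry :: "quat \<Rightarrow> 2 \<Rightarrow> 2 \<Rightarrow> complex" is "\<lambda>A j k. A $ j $ k" .

lemma entry_Quat [simp]:
  "entry (Quat t u) 1 1 = t" "entry (Quat t u) 1 2 = u"
  "entry (Quat t u) 2 1 = - cnj u" "entry (Quat t u) 2 2 = cnj t"
  by (transfer; simp)+

lemma quat_cases [cases type: quat]:
  obtains t u where "z = Quat t u"
  by transfer blast

lemma Quat_entry [simp]: "Quat (entry z 1 1) (entry z 1 2) = z"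
  by (cases z) simp

lemma Quat_eq_iff [simp]: "Quat t u = Quat t' u' \<longleftrightarrow> t = t' \<and> u = u'"
  by (metis entry_Quat(1,2))

instantiation quat :: real_normed_div_algebra
begin

lift_definition zero_quat :: quat is 0
  using qmat_0 by blast

lift_definition one_quat :: quat is "mat 1"
  using qmat_1 by blast

lift_definition plus_quat :: "quat \<Rightarrow> quat \<Rightarrow> quat" is "(+)"
  using qmat_add by blast

lift_definition minus_quat :: "quat \<Rightarrow> quat \<Rightarrow> quat" is "(-)"
  using qmat_diff by blast

lift_definition uminus_quat :: "quat \<Rightarrow> quat" is uminus
  using qmat_minus by blast

lift_definition scaleR_quat :: "real \<Rightarrow> quat \<Rightarrow> quat" is scaleR
  using qmat_scaleR by blast

lift_definition times_quat :: "quat \<Rightarrow> quat \<Rightarrow> quat" is "(**)"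
  using qmat_mult by blast

definition norm_quat :: "quat \<Rightarrow> real" where
  "norm z = sqrt ((cmod (entry z 1 1))\<^sup>2 + (cmod (entry z 1 2))\<^sup>2)"

definition inverse_quat :: "quat \<Rightarrow> quat" where
  "inverse z = inverse ((norm z)\<^sup>2) *\<^sub>R Quat (cnj (entry z 1 1)) (- entry z 1 2)"

definition divide_quat :: "quat \<Rightarrow> quat \<Rightarrow> quat" where
  "x div y = x * inverse (y :: quat)"

definition sgn_quat :: "quat \<Rightarrow> quat" where
  "sgn (z :: quat) = inverse (norm z) *\<^sub>R z"

definition dist_quat :: "quat \<Rightarrow> quat \<Rightarrow> real" where
  "dist x y = norm (x - y :: quat)"

definition uniformity_quat :: "(quat \<times> quat) filter" where
  "(uniformity :: (quat \<times> quat) filter) = (INF e\<in>{0 <..}. principal {(x, y). dist x y < e})"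

definition open_quat :: "quat set \<Rightarrow> bool" where
  "open (U :: quat set) \<longleftrightarrow> (\<forall>x\<in>U. eventually (\<lambda>(x', y). x' = x \<longrightarrow> y \<in> U) uniformity)"

lemma Quat_simps:
  "0 = Quat 0 0" "1 = Quat 1 0"
  "Quat t u + Quat t' u' = Quat (t + t') (u + u')"
  "Quat t u - Quat t' u' = Quat (t - t') (u - u')"
  "- Quat t u = Quat (- t) (- u)"
  "r *\<^sub>R Quat t u = Quat (r *\<^sub>R t) (r *\<^sub>R u)"
  "Quat t u * Quat t' u' = Quat (t * t' - u * cnj u') (t * u' + u * cnj t')"
  by (transfer; simp only: qmat_0 qmat_1 qmat_add qmat_diff qmat_minus qmat_scaleR qmat_mult)+

lemma norm_Quat: "norm (Quat t u) = norm (t, u)"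
  by (simp add: norm_quat_def norm_Pair)

lemma Quat_mult_cnj:
  "Quat t u * Quat (cnj t) (- u) = (norm (Quat t u))\<^sup>2 *\<^sub>R 1"
  "Quat (cnj t) (- u) * Quat t u = (norm (Quat t u))\<^sup>2 *\<^sub>R 1"
  by (simp_all add: Quat_simps norm_quat_def complex_eq_iff cmod_power2)
    (simp_all add: power2_eq_square algebra_simps)

instance
proof
  fix x y z :: quat and r s :: real
  show "x + y + z = x + (y + z)"
    by (cases x; cases y; cases z) (simp add: Quat_simps)
  show "x + y = y + x"
    by (cases x; cases y) (simp add: Quat_simps)
  show "0 + x = x"
    by (cases x) (simp add: Quat_simps)
  show "- x + x = 0"
    by (cases x) (simp add: Quat_simps)
  show "x - y = x + - y"
    by (cases x; cases y) (simp add: Quat_simps)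
  show "x * y * z = x * (y * z)"
    by (cases x; cases y; cases z) (simp add: Quat_simps algebra_simps)
  show "1 * x = x" "x * 1 = x"
    by (cases x; simp add: Quat_simps)+
  show "(x + y) * z = x * z + y * z" "x * (y + z) = x * y + x * z"
    by (cases x; cases y; cases z; simp add: Quat_simps algebra_simps)+
  show "(0::quat) \<noteq> 1"
    by (simp add: Quat_simps)
  show "r *\<^sub>R (x + y) = r *\<^sub>R x + r *\<^sub>R y"
    by (cases x; cases y) (simp add: Quat_simps algebra_simps)
  show "(r + s) *\<^sub>R x = r *\<^sub>R x + s *\<^sub>R x"
    by (cases x) (simp add: Quat_simps algebra_simps)
  show "r *\<^sub>R s *\<^sub>R x = (r * s) *\<^sub>R x" "1 *\<^sub>R x = x"
    by (cases x; simp add: Quat_simps)+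
  show "r *\<^sub>R x * y = r *\<^sub>R (x * y)" "x * r *\<^sub>R y = r *\<^sub>R (x * y)"
    by (cases x; cases y; simp add: Quat_simps algebra_simps)+
  show "norm x = 0 \<longleftrightarrow> x = 0"
    by (cases x) (simp add: norm_Quat Quat_simps zero_prod_def)
  show "norm (x + y) \<le> norm x + norm y"
    by (cases x; cases y) (metis Quat_simps(3) norm_Quat add_Pair norm_triangle_ineq)
  show "norm (r *\<^sub>R x) = \<bar>r\<bar> * norm x"
    by (cases x) (metis Quat_simps(6) norm_Quat scaleR_Pair norm_scaleR)
  show "norm (x * y) = norm x * norm y"
  proof -
    obtain t u t' u' where xy: "x = Quat t u" "y = Quat t' u'"
      by (cases x; cases y) blast
    have "(norm (x * y))\<^sup>2 = (norm x * norm y)\<^sup>2"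
      unfolding xy Quat_simps norm_quat_def power_mult_distrib
      by (simp add: cmod_power2) (simp add: power2_eq_square algebra_simps)
    moreover have "0 \<le> norm x" "0 \<le> norm y" "0 \<le> norm (x * y)"
      by (simp_all add: norm_quat_def)
    ultimately show ?thesis
      by (simp add: power2_eq_iff_nonneg)
  qed
  show "inverse (0::quat) = 0"
    by (simp add: inverse_quat_def norm_quat_def Quat_simps)
  have *: "Quat (cnj t) (- u) * Quat t u = (norm (Quat t u))\<^sup>2 *\<^sub>R 1"
    "Quat t u * Quat (cnj t) (- u) = (norm (Quat t u))\<^sup>2 *\<^sub>R 1"
    "norm (Quat t u) = 0 \<longleftrightarrow> Quat t u = 0"
    for t u
    by (simp_all only: Quat_mult_cnj norm_Quat)
      (simp add: Quat_simps zero_prod_def)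
  have sc: "r *\<^sub>R a * b = r *\<^sub>R (a * b)" "a * r *\<^sub>R b = r *\<^sub>R (a * b)"
    "r *\<^sub>R s *\<^sub>R a = (r * s) *\<^sub>R a" "1 *\<^sub>R a = a" for a b :: quat and r s
    by (cases a; cases b; simp add: Quat_simps algebra_simps)+
  show "x \<noteq> 0 \<Longrightarrow> inverse x * x = 1" "x \<noteq> 0 \<Longrightarrow> x * inverse x = 1"
    by (cases x; simp add: inverse_quat_def * sc)+
qed (simp_all add: divide_quat_def sgn_quat_def dist_quat_def uniformity_quat_def open_quat_def)

end


section \<open>Quaternion \<open>z\<close>-analytic functions\<close>

text \<open>
  A power series \<open>\<Sum>n. c\<^sub>n (z - b)\<^sup>n\<close> is given by its coefficient sequence and a finite product
  \<open>f\<^sup>1(z) \<dots> f\<^sup>l(z)\<close> by the nonempty list of the coefficient sequences of its factors. All balls are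
  closed.
\<close>

type_synonym qseries = "nat \<Rightarrow> quat"

definition qseries_eval :: "quat \<Rightarrow> qseries \<Rightarrow> quat \<Rightarrow> quat" where
  "qseries_eval b c z = (\<Sum>n. c n * (z - b) ^ n)"

definition qproducts :: "quat \<Rightarrow> real \<Rightarrow> qseries list set" where
  "qproducts b R =
     {cs. cs \<noteq> [] \<and> (\<forall>c\<in>set cs. \<forall>z\<in>cball b R. summable (\<lambda>n. c n * (z - b) ^ n))}"

definition qproduct_eval :: "quat \<Rightarrow> qseries list \<Rightarrow> quat \<Rightarrow> quat" where
  "qproduct_eval b cs z = prod_list (map (\<lambda>c. qseries_eval b c z) cs)"

text \<open>
  The supremum is over a bounded set for every member of \<open>qproducts b R\<close> with \<open>R > 0\<close>, since each
  factor converges at \<open>b + R\<close>.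
\<close>

definition omega_norm :: "real \<Rightarrow> qseries list \<Rightarrow> real" where
  "omega_norm R cs = prod_list (map (\<lambda>c. SUP n. norm (c n) * R ^ n) cs)"

text \<open>
  \<open>\<parallel>\<cdot>\<parallel>\<^sub>\<omega>\<close> is attached to products together with their factorisation. On formal real linear
  combinations of products it extends by \<open>\<parallel>\<Sum>j. w\<^sub>j P\<^sub>j\<parallel>\<^sub>\<omega> = \<Sum>j. \<bar>w\<^sub>j\<bar> \<parallel>P\<^sub>j\<parallel>\<^sub>\<omega>\<close>, and the elements of the
  completion are the countable combinations for which this is finite. Taking instead the infimum
  over all representations of the same function is not an option: the powers of \<open>1 \<plusminus> s(z - b)/R\<close>
  and of their inverses (\<open>0 < s < 1\<close>) all get seminorm at most 1, which forces the seminorm of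
  \<open>z - b\<close> to be 0.

  For \<open>\<bar>z - b\<bar> < R\<close> the value of a product of \<open>l\<close> factors is bounded by
  \<open>\<parallel>P\<parallel>\<^sub>\<omega> (1 - \<bar>z - b\<bar>/R)\<^sup>-\<^sup>l\<close> only, which is not uniform in \<open>l\<close>. Hence an element of the
  completion is the function \<open>f\<close> on the ball if the combination converges to \<open>f\<close> there, the
  convergence being unconditional on the ball and normal on all smaller concentric balls. Every
  finite combination satisfies this. Without absolute convergence every continuous function would
  be admitted.
\<close>

definition C_omega_z :: "quat \<Rightarrow> real \<Rightarrow> (quat \<Rightarrow> quat) set" where
  "C_omega_z b R = {f. \<exists>(w :: nat \<Rightarrow> real) (P :: nat \<Rightarrow> qseries list).
     (\<forall>j. P j \<in> qproducts b R) \<and>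
     summable (\<lambda>j. \<bar>w j\<bar> * omega_norm R (P j)) \<and>
     (\<forall>z\<in>cball b R. summable (\<lambda>j. norm (w j *\<^sub>R qproduct_eval b (P j) z)) \<and>
                     (\<lambda>j. w j *\<^sub>R qproduct_eval b (P j) z) sums f z) \<and>
     (\<forall>\<rho><R. \<exists>M. summable M \<and>
        (\<forall>j. \<forall>z\<in>cball b \<rho>. norm (w j *\<^sub>R qproduct_eval b (P j) z) \<le> M j))}"

definition z_analytic_on :: "quat set \<Rightarrow> (quat \<Rightarrow> quat) \<Rightarrow> bool" where
  "z_analytic_on U g \<longleftrightarrow> continuous_on U g \<and>
     (\<forall>b\<in>U. \<exists>R>0. \<exists>h\<in>C_omega_z b R. \<exists>\<epsilon>>0. \<forall>z\<in>U \<inter> ball b \<epsilon>. g z = h z)"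

end

theory Submission
  imports Defs "HOL-Complex_Analysis.Cauchy_Integral_Formula"
begin

text \<open>
  Expand \<open>f\<close> at \<open>t\<^sub>0\<close> as \<open>\<Sum>n. c\<^sub>n (t - t\<^sub>0)\<^sup>n\<close>, with a radius of convergence exceeding \<open>r\<close>. Diagonal
  quaternions form a copy of \<open>\<complex>\<close>, so \<open>\<Sum>n. (z - a)\<^sup>n c\<^sub>n\<close> with \<open>a\<close> diagonal settles the first claim.
  For the second one, right multiplication by \<open>k = Quat 0 (- 1)\<close> makes \<open>z - a = Quat 0 s\<close>
  diagonal, so \<open>\<Sum>n. ((z - a) k)\<^sup>n Quat 0 c\<^sub>n\<close> works.

  Such a series is \<open>z\<close>-analytic at every \<open>b\<close> with \<open>\<bar>b - a\<bar> \<le> r\<close>: the factor \<open>z - a\<close> is the power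
  series \<open>(b - a) + (z - b)\<close> around \<open>b\<close>, of norm \<open>max \<bar>b - a\<bar> R\<close>. Leaving the products unexpanded
  thus makes the \<open>\<omega>\<close>-norm of the \<open>n\<close>-th term at most \<open>\<bar>c\<^sub>n\<bar> (r + \<delta>)\<^sup>n\<close>.
\<close>

lemma dist_Quat: "dist (Quat t u) (Quat t' u') = dist (t, u) (t', u')"
  by (simp add: dist_norm Quat_simps norm_Quat)

text \<open>Completeness passes from pairs of complex numbers through the isometry
  \<open>dist_Quat\<close>. It lets absolutely convergent quaternion series converge.\<close>

instance quat :: banach
proof
  fix X :: "nat \<Rightarrow> quat"
  assume X: "Cauchy X"
  define Y where "Y n = (entry (X n) 1 1, entry (X n) 1 2)" for n
  have "X n = Quat (fst (Y n)) (snd (Y n))" for n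
    by (simp add: Y_def)
  then have dist: "dist (X n) (Quat t u) = dist (Y n) (t, u)"
    and "dist (X m) (X n) = dist (Y m) (Y n)" for m n t u
    by (simp_all add: dist_Quat)
  with X have "Cauchy Y"
    by (simp add: Cauchy_def)
  then obtain t u where "Y \<longlonglongrightarrow> (t, u)"
    by (metis Cauchy_convergent_iff convergent_def surj_pair)
  then have "X \<longlonglongrightarrow> Quat t u"
    unfolding lim_sequentially dist .
  then show "convergent X"
    by (rule convergentI)
qed

definition affine_series :: "quat \<Rightarrow> quat \<Rightarrow> qseries" where
  "affine_series p q n = (if n = 0 then p else if n = 1 then q else 0)"

lemma affine_series_sums: "(\<lambda>n. affine_series p q n * (z - b) ^ n) sums (p + q * (z - b))"
  using sums_finite[of "{0, 1}" "\<lambda>n. affine_series p q n * (z - b) ^ n"]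
  by (simp add: affine_series_def)

lemma qseries_eval_affine_series: "qseries_eval b (affine_series p q) z = p + q * (z - b)"
  unfolding qseries_eval_def using affine_series_sums by (rule sums_unique[symmetric])

text \<open>The supremum is attained at index 0 or 1; all other terms vanish and the maximum is
  nonnegative.\<close>

lemma SUP_affine_series:
  assumes "R > 0"
  shows "(SUP n. norm (affine_series p q n) * R ^ n) = max (norm p) (norm q * R)"
proof (rule cSup_eq_maximum)
  have "max (norm p) (norm q * R) =
      (\<lambda>n. norm (affine_series p q n) * R ^ n) (if norm p \<le> norm q * R then 1 else 0)"
    by (simp add: affine_series_def max_def)
  then show "max (norm p) (norm q * R) \<in> range (\<lambda>n. norm (affine_series p q n) * R ^ n)"
    by (rule range_eqI)
next
  fix x assume "x \<in> range (\<lambda>n. norm (affine_series p q n) * R ^ n)"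
  then show "x \<le> max (norm p) (norm q * R)"
    by (auto simp: affine_series_def le_max_iff_disj)
qed

text \<open>Coefficients of a \<open>qseries\<close> stand to the left of the powers, so the right
  factors \<open>k\<close> and \<open>c\<close> enter as constant series of their own. The last one
  keeps the list nonempty for \<open>n = 0\<close>.\<close>

definition twisted_power :: "quat \<Rightarrow> quat \<Rightarrow> quat \<Rightarrow> nat \<Rightarrow> qseries list" where
  "twisted_power p k c n =
     concat (replicate n [affine_series p 1, affine_series k 0]) @ [affine_series c 0]"

lemma twisted_power_in_qproducts: "twisted_power p k c n \<in> qproducts b R"
  using affine_series_sums[THEN sums_summable]
  by (auto simp: qproducts_def twisted_power_def)

lemma qproduct_eval_twisted_power:
  "qproduct_eval b (twisted_power p k c n) z = ((p + (z - b)) * k) ^ n * c"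
proof -
  have "prod_list (map (\<lambda>c. qseries_eval b c z)
          (concat (replicate n [affine_series p 1, affine_series k 0]))) = ((p + (z - b)) * k) ^ n"
    by (induction n) (simp_all add: qseries_eval_affine_series mult.assoc)
  then show ?thesis
    by (simp add: qproduct_eval_def twisted_power_def qseries_eval_affine_series)
qed

lemma omega_norm_twisted_power:
  assumes "R > 0"
  shows "omega_norm R (twisted_power p k c n) = (max (norm p) R * norm k) ^ n * norm c"
proof -
  have "prod_list (map (\<lambda>c. SUP n. norm (c n) * R ^ n)
          (concat (replicate n [affine_series p 1, affine_series k 0])))
        = (max (norm p) R * norm k) ^ n"
    by (induction n) (simp_all add: SUP_affine_series[OF assms] mult.assoc)
  then show ?thesis
    by (simp add: omega_norm_def twisted_power_def SUP_affine_series[OF assms])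
qed

text \<open>The quaternion norm is multiplicative, so noncommutativity does no harm. This one
  majorant serves the uniform limit as well as the pointwise and normal convergence in
  \<open>C_omega_z\<close>.\<close>

lemma twisted_power_bound:
  fixes a k z c :: quat
  assumes "norm k = 1" "dist z a \<le> s"
  shows "norm (((z - a) * k) ^ n * c) \<le> norm c * s ^ n"
proof -
  have "norm (z - a) ^ n \<le> s ^ n"
    using assms(2) by (intro power_mono) (simp_all add: dist_norm)
  then show ?thesis
    using assms(1) by (simp add: norm_mult norm_power mult.commute mult_left_mono)
qed

lemma z_analytic_on_twisted_series:
  fixes a k :: quat and c :: "nat \<Rightarrow> quat"
  assumes k: "norm k = 1" and r: "0 < r" "r < s" and sm: "summable (\<lambda>n. norm (c n) * s ^ n)"
  shows "z_analytic_on (cball a r) (\<lambda>z. \<Sum>n. ((z - a) * k) ^ n * c n)"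
    (is "z_analytic_on _ ?g")
proof -
  note bound = twisted_power_bound[OF k]
  have unif: "uniform_limit (cball a s) (\<lambda>n z. \<Sum>i<n. ((z - a) * k) ^ i * c i) ?g sequentially"
    using bound by (intro Weierstrass_m_test[OF _ sm]) (simp add: dist_commute)
  have "continuous_on (cball a s) ?g"
    by (rule uniform_limit_theorem[OF _ unif]) (auto intro!: always_eventually continuous_intros)
  then have cont: "continuous_on (cball a r) ?g"
    by (rule continuous_on_subset) (use r in auto)
  have "\<exists>R>0. \<exists>h\<in>C_omega_z b R. \<exists>\<epsilon>>0. \<forall>z\<in>cball a r \<inter> ball b \<epsilon>. ?g z = h z"
    if b: "b \<in> cball a r" for b
  proof -
    \<comment> \<open>With this radius \<open>cball b R\<close> lies in \<open>cball a s\<close> for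
      every \<open>b\<close> in \<open>cball a r\<close>, and both \<open>norm (b - a)\<close> and
      \<open>R\<close> are at most \<open>s\<close>.\<close>
    define R where "R = s - r"
    have R: "R > 0"
      using r by (simp add: R_def)
    have near: "dist z a \<le> s" if "dist b z \<le> R" for z
      using b that dist_triangle[of z a b] by (simp add: R_def dist_commute)
    define P where "P n = twisted_power (b - a) k (c n) n" for n
    have eval: "qproduct_eval b (P n) z = ((z - a) * k) ^ n * c n" for n z
      by (simp add: P_def qproduct_eval_twisted_power)
    \<comment> \<open>The series itself, with all weights 1, is the required element; its terms do
      not depend on \<open>b\<close>, only their factorisations do.\<close>
    have "?g \<in> C_omega_z b R"
      unfolding C_omega_z_def mem_Collect_eq
    proof (rule exI[of _ "\<lambda>_. 1"], rule exI[of _ P], intro conjI allI ballI impI)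
      show "P j \<in> qproducts b R" for j
        by (simp add: P_def twisted_power_in_qproducts)
      have "omega_norm R (P j) \<le> norm (c j) * s ^ j" "0 \<le> omega_norm R (P j)" for j
      proof -
        have "max (norm (b - a)) R \<le> s"
          using b r by (simp add: R_def dist_norm norm_minus_commute)
        then have "max (norm (b - a)) R ^ j \<le> s ^ j"
          by (intro power_mono) (simp_all add: le_max_iff_disj)
        then show "omega_norm R (P j) \<le> norm (c j) * s ^ j"
          by (simp add: P_def omega_norm_twisted_power[OF R] k mult.commute[of "norm (c j)"] mult_right_mono)
        show "0 \<le> omega_norm R (P j)"
          by (simp add: P_def omega_norm_twisted_power[OF R] k le_max_iff_disj)
      qed
      then show "summable (\<lambda>j. \<bar>1\<bar> * omega_norm R (P j))"
        by (intro summable_comparison_test'[OF sm]) simp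
    next
      fix z assume "z \<in> cball b R"
      then have "norm (qproduct_eval b (P j) z) \<le> norm (c j) * s ^ j" for j
        unfolding eval using near bound by simp
      then show *: "summable (\<lambda>j. norm (1 *\<^sub>R qproduct_eval b (P j) z))"
        by (intro summable_comparison_test'[OF sm]) simp
      show "(\<lambda>j. 1 *\<^sub>R qproduct_eval b (P j) z) sums ?g z"
        using summable_sums[OF summable_norm_cancel[OF *]] by (simp add: eval)
    next
      fix \<rho> assume "\<rho> < R"
      then show "\<exists>M. summable M \<and>
          (\<forall>j. \<forall>z\<in>cball b \<rho>. norm (1 *\<^sub>R qproduct_eval b (P j) z) \<le> M j)"
        unfolding eval
        by (intro exI[of _ "\<lambda>j. norm (c j) * s ^ j"] conjI sm allI ballI)
          (simp add: bound near)
    qed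
    with R show ?thesis
      by (intro exI[of _ R] bexI[of _ ?g] conjI) auto
  qed
  then show ?thesis
    unfolding z_analytic_on_def by (intro conjI cont ballI)
qed

lemma analytic_on_cball_power_series:
  fixes f :: "complex \<Rightarrow> complex"
  assumes "0 < r" "f analytic_on cball t0 r"
  obtains c s where "r < s" "summable (\<lambda>n. norm (c n) * s ^ n)"
    "\<And>t. t \<in> cball t0 r \<Longrightarrow> (\<lambda>n. c n * (t - t0) ^ n) sums f t"
proof -
  obtain S where S: "open S" "cball t0 r \<subseteq> S" "f holomorphic_on S"
    using assms(2) unfolding analytic_on_holomorphic by blast
  obtain e where e: "e > 0" "(\<Union>x\<in>cball t0 r. ball x e) \<subseteq> S"
    using compact_subset_open_imp_ball_epsilon_subset[OF compact_cball S(1,2)] by blast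
  \<comment> \<open>Compactness yields \<open>e\<close>-balls around points of the closed disc;
    their union has to be seen to contain a concentric disc on which the Taylor series
    converges.\<close>
  have "ball t0 (r + e) \<subseteq> S"
  proof
    fix t assume t: "t \<in> ball t0 (r + e)"
    show "t \<in> S"
    proof (cases "t \<in> cball t0 r")
      case False
      \<comment> \<open>Radial projection of \<open>t\<close> to the circle of radius
        \<open>r\<close>, at distance \<open>dist t0 t - r < e\<close> from
        \<open>t\<close>.\<close>
      define x where "x = t0 + (r / dist t0 t) *\<^sub>R (t - t0)"
      have d: "dist t0 t > r"
        using False by simp
      then have "dist t0 x = r"
        using assms(1) by (auto simp: x_def dist_norm norm_minus_commute)
      have "t - x = (1 - r / dist t0 t) *\<^sub>R (t - t0)"
        by (simp add: x_def algebra_simps)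
      then have "dist x t = \<bar>1 - r / dist t0 t\<bar> * dist t0 t"
        by (simp add: dist_norm norm_minus_commute)
      moreover have "r / dist t0 t < 1" "dist t0 t \<noteq> 0"
        using d assms(1) by (auto simp: divide_less_eq)
      ultimately have "dist x t = dist t0 t - r"
        by (simp add: left_diff_distrib del: dist_eq_0_iff)
      with \<open>dist t0 x = r\<close> show ?thesis
        using t e(2) by (force simp: subset_eq)
    qed (use S in blast)
  qed
  then have hol: "f holomorphic_on ball t0 (r + e)"
    using S(3) holomorphic_on_subset by blast
  define c where "c n = (deriv ^^ n) f t0 / fact n" for n
  have sums: "(\<lambda>n. c n * (t - t0) ^ n) sums f t" if "t \<in> ball t0 (r + e)" for t
    unfolding c_def by (rule holomorphic_power_series[OF hol that])
  \<comment> \<open>Convergence at radius \<open>r + 2e/3\<close> gives absolute convergence at the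
    smaller radius \<open>r + e/3\<close>, which becomes \<open>s\<close>.\<close>
  have "summable (\<lambda>n. c n * of_real (r + e * 2 / 3) ^ n)"
    using sums[of "t0 + of_real (r + e * 2 / 3)"] assms(1) e(1)
    by (simp add: dist_norm sums_iff del: of_real_add)
  then have "summable (\<lambda>n. norm (c n * of_real (r + e / 3) ^ n))"
    by (rule powser_insidea) (use assms(1) e(1) in \<open>simp del: of_real_add\<close>)
  then have "summable (\<lambda>n. norm (c n) * (r + e / 3) ^ n)"
    using assms(1) e(1) by (simp add: norm_mult norm_power del: of_real_add)
  then show ?thesis
    using e(1) sums by (intro that[of "r + e / 3" c]) auto
qed

lemma Quat_diagonal_power: "Quat t 0 ^ n = Quat (t ^ n) 0"
  by (induction n) (simp_all add: Quat_simps)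

text \<open>These embeddings carry the complex expansion of \<open>f\<close> over to the quaternion
  series on the slices.\<close>

lemma bounded_linear_Quat:
  "bounded_linear (\<lambda>t. Quat t 0)" "bounded_linear (\<lambda>u. Quat 0 u)"
  by (intro bounded_linear_intro[where K = 1]; simp add: Quat_simps norm_Quat norm_Pair)+

theorem proposition3p13:
  fixes t0 :: complex and r :: real and f :: "complex \<Rightarrow> complex"
  assumes "r > 0" and "f analytic_on cball t0 r"
  shows "(\<exists>a g. entry a 1 1 = t0 \<and> z_analytic_on (cball a r) g \<and>
            (\<forall>t\<in>cball t0 r. entry (g (Quat t (entry a 1 2))) 1 1 = f t)) \<and>
         (\<exists>a g. entry a 1 2 = t0 \<and> z_analytic_on (cball a r) g \<and>
            (\<forall>t\<in>cball t0 r. entry (g (Quat (entry a 1 1) t)) 1 2 = f t))"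
proof -
  obtain c s where s: "r < s" "summable (\<lambda>n. norm (c n) * s ^ n)"
    and sums: "\<And>t. t \<in> cball t0 r \<Longrightarrow> (\<lambda>n. c n * (t - t0) ^ n) sums f t"
    using analytic_on_cball_power_series[OF assms] by metis
  show ?thesis
  proof (intro conjI exI ballI)
    \<comment> \<open>The remaining coordinate \<open>u_0\<close> of the centre is 0 in both claims,
      so on the slices \<open>z - a\<close> is \<open>Quat (t - t0) 0\<close> or
      \<open>Quat 0 (t - t0)\<close>.\<close>
    show "entry (Quat t0 0) 1 1 = t0" "entry (Quat 0 t0) 1 2 = t0"
      by simp_all
    show "z_analytic_on (cball (Quat t0 0) r) (\<lambda>z. \<Sum>n. ((z - Quat t0 0) * 1) ^ n * Quat (c n) 0)"
      using assms(1) s by (intro z_analytic_on_twisted_series) (simp_all add: norm_Quat norm_Pair)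
    show "z_analytic_on (cball (Quat 0 t0) r)
        (\<lambda>z. \<Sum>n. ((z - Quat 0 t0) * Quat 0 (- 1)) ^ n * Quat 0 (c n))"
      using assms(1) s by (intro z_analytic_on_twisted_series) (simp_all add: norm_Quat norm_Pair)
  next
    fix t assume t: "t \<in> cball t0 r"
    show "entry (\<Sum>n. ((Quat t (entry (Quat t0 0) 1 2) - Quat t0 0) * 1) ^ n * Quat (c n) 0) 1 1 = f t"
      using bounded_linear.sums[OF bounded_linear_Quat(1) sums[OF t]]
      by (simp add: Quat_simps(3-) Quat_diagonal_power sums_iff mult.commute)
    \<comment> \<open>Here \<open>Quat 0 s * Quat 0 (- 1) = Quat s 0\<close>, and
      \<open>Quat (s ^ n) 0 * Quat 0 (c n)\<close> puts the n-th Taylor term at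
      \<open>s = t - t0\<close> into the entry \<open>1 2\<close>.\<close>
    show "entry (\<Sum>n. ((Quat (entry (Quat 0 t0) 1 1) t - Quat 0 t0) * Quat 0 (- 1)) ^ n
        * Quat 0 (c n)) 1 2 = f t"
      using bounded_linear.sums[OF bounded_linear_Quat(2) sums[OF t]]
      by (simp add: Quat_simps(3-) Quat_diagonal_power sums_iff mult.commute)
  qed
qed

end
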